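(* Let $G$ be a finite simple graph with maximum degree $\Delta(G)\le 6$. Then $\chi'_s(G)\le 57$.
   Context: A strong edge coloring of a graph $G$ is an edge coloring such that every color class is an induced matching of $G$; equivalently, it is a proper vertex coloring of $L(G)^2$, the square of the line graph of $G$. The strong chromatic index $\chi'_s(G)$ is the smallest integer $k$ such that $G$ admits a strong edge coloring with $k$ colors. *)

theory Defs
  imports Main
begin

text \<open>
  A finite simple graph is given by a finite vertex set and a set of edges, each edge being the
  two-element set of its endpoints.
\<close>

definition finite_simple_graph :: "'a set \<Rightarrow> 'a set set \<Rightarrow> bool" where
  "finite_simple_graph V E \<longleftrightarrow> finite V \<and> (\<forall>e\<in>E. e \<subseteq> V \<and> card e = 2)"

definition degree :: "'a set set \<Rightarrow> 'a \<Rightarrow> nat" where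
  "degree E v = card {e \<in> E. v \<in> e}"

text \<open>Inserting 0 only matters for the graph without vertices, whose maximum degree is set to 0.\<close>

definition max_degree :: "'a set \<Rightarrow> 'a set set \<Rightarrow> nat" where
  "max_degree V E = Max (insert 0 (degree E ` V))"

definition matching :: "'a set set \<Rightarrow> 'a set set \<Rightarrow> bool" where
  "matching E M \<longleftrightarrow> M \<subseteq> E \<and> (\<forall>e\<in>M. \<forall>f\<in>M. e \<noteq> f \<longrightarrow> e \<inter> f = {})"

text \<open>
  A matching is induced if it is the whole edge set of the subgraph induced by the vertices
  it covers.
\<close>

definition induced_matching :: "'a set set \<Rightarrow> 'a set set \<Rightarrow> bool" where
  "induced_matching E M \<longleftrightarrow> matching E M \<and> {e \<in> E. e \<subseteq> \<Union>M} = M"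

text \<open>The colors are \<open>0, \<dots>, k - 1\<close>; they need not all be used.\<close>

definition strong_edge_coloring :: "'a set set \<Rightarrow> nat \<Rightarrow> ('a set \<Rightarrow> nat) \<Rightarrow> bool" where
  "strong_edge_coloring E k c \<longleftrightarrow>
     (\<forall>e\<in>E. c e < k) \<and> (\<forall>i<k. induced_matching E {e \<in> E. c e = i})"

definition strong_chromatic_index :: "'a set set \<Rightarrow> nat" where
  "strong_chromatic_index E = (LEAST k. \<exists>c. strong_edge_coloring E k c)"

text \<open>The minimum in the definition above is attained for every finite simple graph.\<close>

lemma finite_simple_graph_finite_edges:
  assumes "finite_simple_graph V E"
  shows "finite E"
proof (rule finite_subset)
  show "E \<subseteq> Pow V" using assms by (auto simp: finite_simple_graph_def)
  show "finite (Pow V)" using assms by (simp add: finite_simple_graph_def)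
qed

lemma strong_edge_coloring_exists:
  assumes G: "finite_simple_graph V E"
  shows "\<exists>k c. strong_edge_coloring E k c"
proof -
  obtain c :: "'a set \<Rightarrow> nat" where c: "bij_betw c E {0..<card E}"
    using ex_bij_betw_finite_nat[OF finite_simple_graph_finite_edges[OF G]] by blast
  have "induced_matching E {e \<in> E. c e = i}" if "i < card E" for i
  proof -
    have "i \<in> c ` E" using c that by (simp add: bij_betw_def)
    then obtain e where e: "e \<in> E" "c e = i" by blast
    have cls: "{e \<in> E. c e = i} = {e}"
      using c e by (auto simp: bij_betw_def inj_on_def)
    have "f = e" if "f \<in> E" "f \<subseteq> e" for f
    proof (rule card_subset_eq)
      have "card e = 2" "card f = 2" using G e that by (auto simp: finite_simple_graph_def)
      then show "finite e" "card f = card e" by (auto intro: card_ge_0_finite)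
    qed (use that in auto)
    then show ?thesis
      unfolding cls induced_matching_def matching_def using e by auto
  qed
  moreover have "\<forall>e\<in>E. c e < card E" using c by (auto simp: bij_betw_def)
  ultimately show ?thesis unfolding strong_edge_coloring_def by blast
qed

lemma strong_chromatic_index_attained:
  assumes "finite_simple_graph V E"
  shows "\<exists>c. strong_edge_coloring E (strong_chromatic_index E) c"
  unfolding strong_chromatic_index_def
  using strong_edge_coloring_exists[OF assms] by (rule LeastI_ex)

end

theory Submission
  imports Defs
begin

text \<open>
  An edge conflicts with at most 60 others. Colour the edges of a connected graph greedily, those
  far from a vertex \<open>v\<close> first: an edge not at \<open>v\<close> has a neighbouring vertex \<open>w\<close> closer to
  \<open>v\<close> whose edges come later, so it sees at most 54 colours. Only the six edges at \<open>v\<close>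
  are critical; they are helped by 4-cycles and triangles (each lowers the number of conflicts)
  and by colouring some edges near \<open>v\<close> in advance so that colours repeat. At most two of these
  share a vertex \<open>w\<close>, which raises the 54 above to 56 and still leaves one of 57 colours.
  In a counterexample the choice of \<open>v\<close> then successively rules out vertices of degree less than
  6, triangles, and pairs of vertices with at least 4, 3 and 2 common neighbours. Without
  4-cycles, two colours used on three edges each give the four repetitions required.
\<close>

section \<open>Conflicts, partial colourings and greedy extension\<close>

definition nbrs :: "'a set set \<Rightarrow> 'a \<Rightarrow> 'a set" where
  "nbrs E v = {u. {v, u} \<in> E}"

text \<open>On edges of \<open>E\<close> this is adjacency in the square of the line graph.\<close>

definition conflict :: "'a set set \<Rightarrow> 'a set \<Rightarrow> 'a set \<Rightarrow> bool" where
  "conflict E e f \<longleftrightarrow> e \<noteq> f \<and> (\<exists>a\<in>e. \<exists>b\<in>f. a = b \<or> {a, b} \<in> E)"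

text \<open>Conflicts are taken in \<open>E\<close>, not in \<open>S\<close>: an uncoloured edge can
  still join two coloured ones, so a colouring of \<open>S\<close> stays usable when it is
  extended.\<close>

definition partial_coloring :: "'a set set \<Rightarrow> nat \<Rightarrow> 'a set set \<Rightarrow> ('a set \<Rightarrow> nat) \<Rightarrow> bool" where
  "partial_coloring E k S c \<longleftrightarrow>
     (\<forall>e\<in>S. c e < k) \<and> (\<forall>e\<in>S. \<forall>f\<in>S. conflict E e f \<longrightarrow> c e \<noteq> c f)"

lemma conflict_sym: "conflict E e f \<longleftrightarrow> conflict E f e"
proof -
  have "conflict E f e" if "conflict E e f" for e f
    using that unfolding conflict_def by (metis insert_commute)
  then show ?thesis by blast
qed

lemma mem_nbrs_sym: "u \<in> nbrs E v \<longleftrightarrow> v \<in> nbrs E u"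
  by (simp add: nbrs_def insert_commute)

lemma card_filter:
  assumes "finite A"
  shows "card {x \<in> A. P x} = (\<Sum>x\<in>A. if P x then 1 else 0)"
  using assms by (simp add: sum.If_cases Int_def)

lemma obtain_distinct:
  assumes "n \<le> card A"
  obtains xs where "distinct xs" "length xs = n" "set xs \<subseteq> A"
proof -
  obtain B where B: "B \<subseteq> A" "card B = n" "finite B"
    using obtain_subset_with_card_n[OF assms] by metis
  then obtain xs where "set xs = B" "distinct xs" using finite_distinct_list by blast
  moreover from this have "length xs = n" using B(2) distinct_card by fastforce
  ultimately show ?thesis using that[of xs] B(1) by blast
qed

text \<open>The edge chosen for \<open>X\<close> is the one among \<open>X\<close> to be coloured last.\<close>

lemma extend_coloring:
  assumes "finite U" and "finite Q" and "partial_coloring E (Suc k) Q c"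
    and "\<And>X. X \<subseteq> U \<Longrightarrow> X \<noteq> {} \<Longrightarrow>
      \<exists>e\<in>X. \<forall>c'. (\<forall>q\<in>Q. c' q = c q) \<longrightarrow> card (c' ` ({f. conflict E e f} \<inter> (Q \<union> X))) \<le> k"
    and "Q \<inter> U = {}"
  shows "\<exists>c'. partial_coloring E (Suc k) (Q \<union> U) c' \<and> (\<forall>q\<in>Q. c' q = c q)"
  using assms(1,4,5)
proof (induction U rule: finite_psubset_induct)
  case (psubset U)
  show ?case
  proof (cases "U = {}")
    case True
    then show ?thesis using assms(3) by auto
  next
    case False
    \<comment> \<open>The bound is needed for all \<open>c'\<close> that agree with \<open>c\<close>
      on \<open>Q\<close>, since \<open>e\<close> is fixed before the rest of \<open>U\<close> is
      coloured; only the repetitions on \<open>Q\<close> are known by then.\<close>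
    then obtain e where e: "e \<in> U" and
      few: "\<And>c'. (\<forall>q\<in>Q. c' q = c q) \<Longrightarrow> card (c' ` ({f. conflict E e f} \<inter> (Q \<union> U))) \<le> k"
      using psubset.prems(1)[of U] by blast
    have "\<exists>c'. partial_coloring E (Suc k) (Q \<union> (U - {e})) c' \<and> (\<forall>q\<in>Q. c' q = c q)"
    proof (rule psubset.IH)
      show "U - {e} \<subset> U" using e by blast
      show "Q \<inter> (U - {e}) = {}" using psubset.prems(2) by blast
      fix X assume "X \<subseteq> U - {e}" "X \<noteq> {}"
      then show "\<exists>e\<in>X. \<forall>c'. (\<forall>q\<in>Q. c' q = c q) \<longrightarrow>
          card (c' ` ({f. conflict E e f} \<inter> (Q \<union> X))) \<le> k"
        using psubset.prems(1)[of X] by blast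
    qed
    then obtain c1 where c1: "partial_coloring E (Suc k) (Q \<union> (U - {e})) c1" "\<forall>q\<in>Q. c1 q = c q"
      by blast
    let ?used = "c1 ` ({f. conflict E e f} \<inter> (Q \<union> U))"
    have "finite ?used" using psubset.hyps assms(2) by blast
    moreover have "card ?used < card {..<Suc k}" using few[OF c1(2)] by simp
    ultimately have "\<not> {..<Suc k} \<subseteq> ?used"
      by (meson card_mono leD)
    then obtain i where i: "i < Suc k" "i \<notin> ?used" by blast
    have "e \<notin> Q" using e psubset.prems(2) by blast
    have diff: "c1 f \<noteq> i" if "f \<in> Q \<union> U" "conflict E e f" for f
      using i(2) that by blast
    have "partial_coloring E (Suc k) (Q \<union> U) (c1(e := i))"
      unfolding partial_coloring_def
    proof (intro conjI ballI impI)
      fix f g assume fg: "f \<in> Q \<union> U" "g \<in> Q \<union> U" "conflict E f g"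
      have "f \<noteq> g" "conflict E g f"
        using fg(3) conflict_sym[of E f g] by (simp_all add: conflict_def)
      then consider "f = e" "g \<noteq> e" | "f \<noteq> e" "g = e" | "f \<noteq> e" "g \<noteq> e" by blast
      then show "(c1(e := i)) f \<noteq> (c1(e := i)) g"
      proof cases
        case 1
        then show ?thesis using diff[of g] fg by simp
      next
        case 2
        then show ?thesis using diff[of f] fg \<open>conflict E g f\<close> by simp
      next
        case 3
        then show ?thesis using fg c1(1) by (simp add: partial_coloring_def)
      qed
    next
      fix f assume "f \<in> Q \<union> U"
      then show "(c1(e := i)) f < Suc k" using i(1) c1(1) by (simp add: partial_coloring_def)
    qed
    moreover have "\<forall>q\<in>Q. (c1(e := i)) q = c q" using c1(2) \<open>e \<notin> Q\<close> by auto
    ultimately have "partial_coloring E (Suc k) (Q \<union> U) (c1(e := i)) \<and>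
        (\<forall>q\<in>Q. (c1(e := i)) q = c q)" by blast
    then show ?thesis by blast
  qed
qed

section \<open>Counting the edges in conflict with a given edge\<close>

locale degree6_graph =
  fixes E :: "'a set set"
  assumes finite_E: "finite E"
    and card_edge: "e \<in> E \<Longrightarrow> card e = 2"
    and degree_le: "degree E v \<le> 6"
begin

abbreviation adj :: "'a \<Rightarrow> 'a \<Rightarrow> bool" where "adj u v \<equiv> {u, v} \<in> E"
abbreviation nb :: "'a \<Rightarrow> 'a set" where "nb \<equiv> nbrs E"
abbreviation inc :: "'a \<Rightarrow> 'a set set" where "inc v \<equiv> {e \<in> E. v \<in> e}"
abbreviation near :: "'a set \<Rightarrow> 'a set set" where "near e \<equiv> {f \<in> E. conflict E e f}"

lemma not_adj_self: "\<not> adj v v"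
  using card_edge[of "{v, v}"] by auto

lemma not_mem_nb_self: "v \<notin> nb v"
  using not_adj_self by (simp add: nbrs_def)

lemma edge_cases:
  assumes "e \<in> E"
  obtains a b where "e = {a, b}" "a \<noteq> b"
  using card_edge[OF assms] by (meson card_2_iff)

lemma edge_at_cases:
  assumes "e \<in> E" "v \<in> e"
  obtains u where "e = {v, u}" "v \<noteq> u" "u \<in> nb v"
proof -
  obtain a b where "e = {a, b}" "a \<noteq> b" using edge_cases[OF assms(1)] .
  then have "\<exists>u. e = {v, u} \<and> v \<noteq> u" using assms(2) by blast
  then obtain u where "e = {v, u}" "v \<noteq> u" by blast
  then show ?thesis using assms(1) that[of u] by (simp add: nbrs_def)
qed

lemma inc_eq_image: "inc v = (\<lambda>u. {v, u}) ` nb v"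
proof
  show "inc v \<subseteq> (\<lambda>u. {v, u}) ` nb v"
  proof
    fix e assume "e \<in> inc v"
    then have "e \<in> E" "v \<in> e" by simp_all
    then obtain u where "e = {v, u}" "v \<noteq> u" "u \<in> nb v" by (rule edge_at_cases)
    then show "e \<in> (\<lambda>u. {v, u}) ` nb v" by simp
  qed
  show "(\<lambda>u. {v, u}) ` nb v \<subseteq> inc v" by (auto simp: nbrs_def)
qed

lemma inj_on_edge: "inj_on (\<lambda>u. {v, u}) A"
  by (auto simp: inj_on_def doubleton_eq_iff)

lemma card_nb: "card (nb v) = degree E v"
  unfolding degree_def inc_eq_image by (simp add: card_image inj_on_edge)

lemma card_nb_le: "card (nb v) \<le> 6"
  using degree_le by (simp add: card_nb)

lemma finite_nb [simp]: "finite (nb v)"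
proof -
  have "finite (inc v)" using finite_E by simp
  then show ?thesis unfolding inc_eq_image by (rule finite_imageD) (rule inj_on_edge)
qed

text \<open>Every edge in conflict with the edge \<open>{a, b}\<close> meets this set. At most 10
  vertices of degree at most 6 yield the bound 60; each improvement removes a vertex or finds edges
  inside the set.\<close>

definition surround :: "'a \<Rightarrow> 'a \<Rightarrow> 'a set" where
  "surround a b = (nb a \<union> nb b) - {a, b}"

lemma finite_surround [simp]: "finite (surround a b)"
  by (simp add: surround_def)

text \<open>A conflicting edge through \<open>a\<close> or \<open>b\<close> has its other end in the
  set, since it differs from \<open>{a, b}\<close>; one that misses both has an end adjacent to
  \<open>a\<close> or \<open>b\<close>.\<close>

lemma near_subset:
  assumes "adj a b"
  shows "near {a, b} \<subseteq> (\<Union>z\<in>surround a b. inc z)"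
proof
  fix f assume f: "f \<in> near {a, b}"
  then have fE: "f \<in> E" and ne: "f \<noteq> {a, b}" by (auto simp: conflict_def)
  have "\<exists>z\<in>f. z \<in> surround a b" if "x \<in> f" "x \<in> {a, b}" for x
  proof -
    obtain u where "f = {x, u}" "x \<noteq> u" "u \<in> nb x" using edge_at_cases fE \<open>x \<in> f\<close> .
    then show ?thesis using ne that by (auto simp: surround_def)
  qed
  moreover have "\<exists>z\<in>f. z \<in> surround a b" if "x \<in> f" "x \<notin> {a, b}" "adj a x \<or> adj b x" for x
    using that by (auto simp: surround_def nbrs_def)
  ultimately have "\<exists>z\<in>f. z \<in> surround a b"
    using f by (auto simp: conflict_def) 
  then show "f \<in> (\<Union>z\<in>surround a b. inc z)" using fE by blast
qed

lemma card_Union_inc: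
  assumes "finite Z" "F \<subseteq> E" "\<And>f. f \<in> F \<Longrightarrow> f \<subseteq> Z"
  shows "card (\<Union>z\<in>Z. inc z) + card F \<le> 6 * card Z"
proof -
  let ?U = "\<Union>z\<in>Z. inc z"
  have finU: "finite ?U" using finite_E by (rule finite_subset[rotated]) blast
  have FU: "F \<subseteq> ?U"
  proof
    fix f assume f: "f \<in> F"
    then obtain a b where "f = {a, b}" using assms(2) edge_cases by blast
    then show "f \<in> ?U" using f assms(2) assms(3)[OF f] by blast
  qed
  have "{f \<in> ?U. f \<in> F} = F" using FU by blast
  then have "card ?U + card F = (\<Sum>f\<in>?U. 1 + (if f \<in> F then 1 else 0))"
    using card_filter[OF finU, of "\<lambda>f. f \<in> F"] by (simp only: sum.distrib card_eq_sum)
  \<comment> \<open>double counting: edges inside \<open>Z\<close> are met from both ends\<close>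
  also have "\<dots> \<le> (\<Sum>f\<in>?U. card (f \<inter> Z))"
  proof (rule sum_mono)
    fix f assume f: "f \<in> ?U"
    have "finite (f \<inter> Z)" using assms(1) by simp
    show "1 + (if f \<in> F then 1 else 0) \<le> card (f \<inter> Z)"
    proof (cases "f \<in> F")
      case True
      then have "f \<inter> Z = f" "card f = 2" using assms(2,3) card_edge by auto
      then show ?thesis by simp
    next
      case False
      have "f \<inter> Z \<noteq> {}" using f by blast
      then have "card (f \<inter> Z) > 0" using \<open>finite (f \<inter> Z)\<close> by (simp only: card_gt_0_iff) blast
      then show ?thesis using False by simp
    qed
  qed
  also have "\<dots> = (\<Sum>f\<in>?U. \<Sum>z\<in>Z. if z \<in> f then 1 else 0)"
    by (simp only: card_filter[OF assms(1), symmetric]) (simp add: Int_def conj_commute)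
  also have "\<dots> = (\<Sum>z\<in>Z. \<Sum>f\<in>?U. if z \<in> f then 1 else 0)"
    by (rule sum.swap)
  also have "\<dots> = (\<Sum>z\<in>Z. card (inc z))"
  proof (rule sum.cong[OF refl])
    fix z assume "z \<in> Z"
    then have "{f \<in> ?U. z \<in> f} = inc z" by blast
    then show "(\<Sum>f\<in>?U. if z \<in> f then 1 else 0) = card (inc z)"
      by (simp only: card_filter[OF finU, symmetric])
  qed
  also have "\<dots> \<le> (\<Sum>z\<in>Z. 6)"
    using degree_le by (intro sum_mono) (simp add: degree_def)
  finally show ?thesis by simp
qed

text \<open>Each of the two neighbourhoods contributes at most 5 vertices besides \<open>a\<close>
  and \<open>b\<close>. A common neighbour is counted twice, and a degree of at most 5 loses one
  vertex.\<close>

lemma card_surround: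
  assumes "adj a b"
  shows "card (surround a b) \<le> 10"
    and "nb a \<inter> nb b \<noteq> {} \<Longrightarrow> card (surround a b) \<le> 9"
    and "card (nb a) \<le> 5 \<Longrightarrow> card (surround a b) \<le> 9"
proof -
  have mem: "b \<in> nb a" "a \<in> nb b" using assms by (auto simp: nbrs_def insert_commute)
  have eq: "surround a b = (nb a - {b}) \<union> (nb b - {a})"
    using not_mem_nb_self by (auto simp: surround_def)
  have cards: "card (nb a - {b}) = card (nb a) - 1" "card (nb b - {a}) = card (nb b) - 1"
    using mem by simp_all
  have sum: "card (surround a b) + card ((nb a - {b}) \<inter> (nb b - {a})) =
      (card (nb a) - 1) + (card (nb b) - 1)"
    unfolding eq cards[symmetric] by (rule card_Un_Int[symmetric]) simp_all
  show "card (surround a b) \<le> 10" "card (nb a) \<le> 5 \<Longrightarrow> card (surround a b) \<le> 9"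
    using sum card_nb_le[of a] card_nb_le[of b] by linarith+
  assume "nb a \<inter> nb b \<noteq> {}"
  then have "(nb a - {b}) \<inter> (nb b - {a}) \<noteq> {}" using not_mem_nb_self by blast
  then have "card ((nb a - {b}) \<inter> (nb b - {a})) > 0" by (simp add: card_gt_0_iff)
  then show "card (surround a b) \<le> 9" using sum card_nb_le[of a] card_nb_le[of b] by linarith
qed

text \<open>An edge inside the set closes a triangle at \<open>a\<close> or \<open>b\<close>, or a
  4-cycle through \<open>{a, b}\<close>. It is met from both ends, so each one lowers the bound 60 =
  6 * 10 by one.\<close>

lemma card_near_plus:
  assumes "adj a b" "F \<subseteq> E" "\<And>f. f \<in> F \<Longrightarrow> f \<subseteq> surround a b"
  shows "card (near {a, b}) + card F \<le> 60"
proof -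
  have "card (near {a, b}) \<le> card (\<Union>z\<in>surround a b. inc z)"
    by (rule card_mono[OF _ near_subset[OF assms(1)]]) (use finite_E in auto)
  then show ?thesis
    using card_Union_inc[OF _ assms(2,3)] card_surround(1)[OF assms(1)] by fastforce
qed

lemma card_near_le_54:
  assumes "adj a b" "card (surround a b) \<le> 9"
  shows "card (near {a, b}) \<le> 54"
proof -
  have "card (near {a, b}) \<le> card (\<Union>z\<in>surround a b. inc z)"
    by (rule card_mono[OF _ near_subset[OF assms(1)]]) (use finite_E in auto)
  then show ?thesis
    using card_Union_inc[of "surround a b" "{}"] assms(2) by simp
qed

text \<open>This is the bound behind the greedy order: if the edges at \<open>w\<close> are still
  uncoloured, nine vertices remain, and 6 * 9 = 54.\<close>

lemma card_near_away:
  assumes "adj a b" "w \<in> surround a b"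
  shows "card (near {a, b} - inc w) \<le> 54"
proof -
  let ?Z = "surround a b - {w}"
  have "near {a, b} - inc w \<subseteq> (\<Union>z\<in>?Z. inc z)"
    using near_subset[OF assms(1)] by blast
  then have "card (near {a, b} - inc w) \<le> card (\<Union>z\<in>?Z. inc z)"
    by (rule card_mono[rotated]) (use finite_E in auto)
  moreover have "card ?Z \<le> 9" using card_surround(1)[OF assms(1)] assms(2) by simp
  ultimately show ?thesis using card_Union_inc[of ?Z "{}"] by simp
qed

text \<open>Each further common neighbour \<open>t\<close> gives the 4-cycle x, t, y, z and hence
  the edge \<open>{y, t}\<close> inside \<open>surround x z\<close>. The edges in \<open>G\<close>
  avoid \<open>y\<close>, so they count in addition.\<close>

lemma card_common_plus:
  assumes "x \<noteq> y" "z \<in> nb x \<inter> nb y"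
    and G: "G \<subseteq> E" "\<And>f. f \<in> G \<Longrightarrow> f \<subseteq> surround x z \<and> y \<notin> f"
  shows "card (near {x, z}) + (card (nb x \<inter> nb y) - 1) + card G \<le> 60"
proof -
  let ?F = "(\<lambda>t. {y, t}) ` (nb x \<inter> nb y - {z})"
  have "card (near {x, z}) + card (?F \<union> G) \<le> 60"
  proof (rule card_near_plus)
    show "adj x z" "?F \<union> G \<subseteq> E" using assms by (auto simp: nbrs_def)
    fix f assume "f \<in> ?F \<union> G"
    then show "f \<subseteq> surround x z"
      using assms mem_nbrs_sym[of z E y] not_mem_nb_self by (auto simp: surround_def)
  qed
  moreover have "card (?F \<union> G) = card ?F + card G"
    using G finite_E finite_subset by (intro card_Un_disjoint) auto
  moreover have "card ?F = card (nb x \<inter> nb y) - 1"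
    using assms(2) by (simp add: card_image[OF inj_on_edge])
  ultimately show ?thesis by simp
qed

end

section \<open>Connected counterexamples and greedy colouring towards a center\<close>

locale critical_graph = degree6_graph +
  assumes connected: "u \<in> \<Union>E \<Longrightarrow> v \<in> \<Union>E \<Longrightarrow> (u, v) \<in> {(x, y). {x, y} \<in> E}\<^sup>*"
    and uncolorable: "\<not> partial_coloring E 57 E c"
begin

text \<open>The rank is the distance from \<open>v\<close>; the last step of a shortest walk comes
  from a closer vertex. It orders the edges in \<open>center\<close>.\<close>

lemma rank_exists:
  assumes "v \<in> \<Union>E"
  shows "\<exists>r :: 'a \<Rightarrow> nat. \<forall>w\<in>\<Union>E. w \<noteq> v \<longrightarrow> (\<exists>u\<in>nb w. r u < r w)"
proof -
  let ?A = "{(x, y). {x, y} \<in> E}"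
  define r where "r w = (LEAST n. (v, w) \<in> ?A ^^ n)" for w
  have "\<exists>u\<in>nb w. r u < r w" if "w \<in> \<Union>E" "w \<noteq> v" for w
  proof -
    have "\<exists>n. (v, w) \<in> ?A ^^ n" using connected[OF assms that(1)] rtrancl_imp_relpow by blast
    then have r: "(v, w) \<in> ?A ^^ r w" unfolding r_def by (rule LeastI_ex)
    have "r w \<noteq> 0" using r that(2) by (metis relpow_0_E)
    then obtain m where m: "r w = Suc m" using not0_implies_Suc by blast
    obtain u where u: "(v, u) \<in> ?A ^^ m" "(u, w) \<in> ?A"
      using r unfolding m by (rule relpow_Suc_E)
    have "r u \<le> m" unfolding r_def using u(1) by (rule Least_le)
    moreover have "u \<in> nb w" using u(2) by (simp add: nbrs_def insert_commute)
    ultimately show ?thesis unfolding m using le_imp_less_Suc by blast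
  qed
  then show ?thesis by blast
qed

text \<open>
  Here \<open>P\<close> is coloured in advance, with \<open>R\<close> repetitions. The edges \<open>{v, x}\<close> come last, in
  order of increasing \<open>s x\<close>.
\<close>

lemma center:
  fixes s :: "'a \<Rightarrow> nat"
  assumes v: "v \<in> \<Union>E"
    and P: "\<And>x. x \<in> nb v \<Longrightarrow> P \<subseteq> near {v, x}"
    and p: "partial_coloring E 57 P p"
    and P2: "\<And>w. card {e \<in> P. w \<in> e} \<le> 2"
    and R: "card (p ` P) + R \<le> card P"
    and slack: "\<And>x. x \<in> nb v \<Longrightarrow> card (near {v, x}) + s x \<le> 60"
    and enough: "\<And>x. x \<in> nb v \<Longrightarrow> 4 \<le> R + s x + card {y \<in> nb v. s x < s y}"
  shows False
proof -
  obtain r :: "'a \<Rightarrow> nat" where r: "\<And>w. w \<in> \<Union>E \<Longrightarrow> w \<noteq> v \<Longrightarrow> \<exists>u\<in>nb w. r u < r w"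
    using rank_exists[OF v] by blast
  have PE: "P \<subseteq> E"
  proof -
    obtain e where "e \<in> E" "v \<in> e" using v by blast
    then obtain x where "x \<in> nb v" by (rule edge_at_cases)
    then show ?thesis using P by blast
  qed
  then have finP: "finite P" using finite_E finite_subset by blast
  \<comment> \<open>An edge \<open>{v, x}\<close> in \<open>P\<close> would have to conflict with
    itself.\<close>
  have vP: "v \<notin> e" if "e \<in> P" for e
  proof
    assume "v \<in> e"
    moreover have "e \<in> E" using PE that by blast
    ultimately obtain x where x: "e = {v, x}" "x \<in> nb v" using edge_at_cases by metis
    then have "e \<in> near {v, x}" using P that by blast
    then show False using x(1) by (simp add: conflict_def)
  qed
  have "\<exists>c'. partial_coloring E (Suc 56) (P \<union> (E - P)) c' \<and> (\<forall>q\<in>P. c' q = p q)"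
  proof (rule extend_coloring)
    show "finite (E - P)" "finite P" using finite_E finP by simp_all
    show "partial_coloring E (Suc 56) P p" using p by simp
    show "P \<inter> (E - P) = {}" by blast
    fix X assume X: "X \<subseteq> E - P" "X \<noteq> {}"
    have finX: "finite X" using X(1) finite_E finite_subset by blast
    define T where "T e = {f. conflict E e f} \<inter> (P \<union> X)" for e
    have T_near: "T e \<subseteq> near e" for e using PE X(1) by (auto simp: T_def)
    have finT: "finite (T e)" for e using finP finX by (simp add: T_def)
    have "\<exists>e\<in>X. \<forall>c'. (\<forall>q\<in>P. c' q = p q) \<longrightarrow> card (c' ` T e) \<le> 56"
    proof (cases "\<exists>e\<in>X. v \<in> e")
      case True
      define Y where "Y = {x \<in> nb v. {v, x} \<in> X}"
      have "Y \<noteq> {}"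
      proof -
        obtain e where e: "e \<in> X" "v \<in> e" using True by blast
        then have "e \<in> E" using X(1) by blast
        then obtain x where "e = {v, x}" "x \<in> nb v" using edge_at_cases e(2) by metis
        then show ?thesis using e(1) by (auto simp: Y_def)
      qed
      have finY: "finite Y" by (simp add: Y_def)
      have "Max (s ` Y) \<in> s ` Y" using \<open>Y \<noteq> {}\<close> finY by simp
      then obtain x where x: "x \<in> Y" "s x = Max (s ` Y)" by auto
      have xv: "x \<in> nb v" and eX: "{v, x} \<in> X" using x(1) by (simp_all add: Y_def)
      \<comment> \<open>The edges at \<open>v\<close> with larger \<open>s\<close> come later: as
        \<open>s x\<close> is maximal on \<open>Y\<close>, they are not in \<open>X\<close>, and
        none of them is in \<open>P\<close>. They are conflicts of \<open>{v, x}\<close> without a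
        colour.\<close>
      define L where "L = (\<lambda>y. {v, y}) ` {y \<in> nb v. s x < s y}"
      have "L \<subseteq> near {v, x}"
      proof
        fix f assume "f \<in> L"
        then obtain y where y: "f = {v, y}" "y \<in> nb v" "s x < s y" by (auto simp: L_def)
        then have "f \<noteq> {v, x}" by (auto simp: doubleton_eq_iff)
        then show "f \<in> near {v, x}" using y by (auto simp: conflict_def nbrs_def)
      qed
      moreover have "L \<inter> T {v, x} = {}"
      proof -
        have "f \<notin> P \<union> X" if "f \<in> L" for f
        proof -
          obtain y where y: "f = {v, y}" "y \<in> nb v" "s x < s y" using \<open>f \<in> L\<close> by (auto simp: L_def)
          have "s t \<le> s x" if "t \<in> Y" for t using x(2) finY that by simp
          then have "y \<notin> Y" using y(3) leD by blast
          then show ?thesis using y vP[of f] by (auto simp: Y_def)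
        qed
        then show ?thesis by (auto simp: T_def)
      qed
      ultimately have "T {v, x} \<subseteq> near {v, x} - L" using T_near by blast
      moreover have finnear: "finite (near {v, x})" using finite_E by simp
      ultimately have "card (T {v, x}) \<le> card (near {v, x} - L)" by (intro card_mono) simp_all
      also have "\<dots> = card (near {v, x}) - card L"
        using \<open>L \<subseteq> near {v, x}\<close> finnear finite_subset by (intro card_Diff_subset) auto
      also have "card L = card {y \<in> nb v. s x < s y}"
        unfolding L_def by (rule card_image[OF inj_on_edge])
      \<comment> \<open>There are at most 60 - \<open>s x\<close> conflicts, of which at least 4 -
        \<open>R\<close> - \<open>s x\<close> come later by \<open>enough\<close>.\<close>
      finally have T: "card (T {v, x}) \<le> 56 + R"
        using slack[OF xv] enough[OF xv] by linarith
      have "card (c' ` T {v, x}) \<le> 56" if c': "\<forall>q\<in>P. c' q = p q" for c'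
      proof -
        \<comment> \<open>All of \<open>P\<close> conflicts with \<open>{v, x}\<close> and shows at
          least \<open>R\<close> fewer colours than edges, so the 56 + \<open>R\<close> edges show
          at most 56 colours.\<close>
        have PT: "P \<subseteq> T {v, x}" using P[OF xv] by (auto simp: T_def)
        have "c' ` T {v, x} = p ` P \<union> c' ` (T {v, x} - P)" using PT c' by force
        then have "card (c' ` T {v, x}) \<le> card (p ` P) + card (c' ` (T {v, x} - P))"
          by (simp add: card_Un_le)
        also have "\<dots> \<le> card (p ` P) + card (T {v, x} - P)"
          using card_image_le[of "T {v, x} - P" c'] finT by simp
        also have "card (T {v, x} - P) = card (T {v, x}) - card P"
          using PT finP by (simp add: card_Diff_subset)
        finally have "card (c' ` T {v, x}) \<le> card (p ` P) + (card (T {v, x}) - card P)" .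
        moreover have "card P \<le> card (T {v, x})" using PT finT by (simp add: card_mono)
        ultimately show ?thesis using T R by linarith
      qed
      then show ?thesis using eX by blast
    next
      case False
      \<comment> \<open>The edge of \<open>X\<close> closest to \<open>v\<close> comes last. Its
        nearer end \<open>y\<close> has a neighbour \<open>u\<close> of smaller rank, so no edge of
        \<open>X\<close> contains \<open>u\<close>. Coloured edges at \<open>u\<close> then belong
        to \<open>P\<close>, which has at most 2 of them.\<close>
      define l where "l e = Min (r ` e)" for e
      have "Min (l ` X) \<in> l ` X" using X(2) finX by simp
      then obtain e where e: "e \<in> X" "l e = Min (l ` X)" by auto
      have eE: "e \<in> E" and ve: "v \<notin> e" using e(1) X(1) False by blast+
      have fin_e: "finite f" if "f \<in> E" for f using card_edge[OF that] card.infinite by fastforce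
      have "e \<noteq> {}" using card_edge[OF eE] by auto
      then have "l e \<in> r ` e" unfolding l_def using fin_e[OF eE] by simp
      then obtain y where y: "y \<in> e" "r y = l e" by auto
      then have "y \<in> \<Union>E" "y \<noteq> v" using eE ve by blast+
      then obtain u where u: "u \<in> nb y" "r u < r y" using r by blast
      obtain y' where y': "e = {y, y'}" "y \<noteq> y'" "y' \<in> nb y" using edge_at_cases[OF eE y(1)] .
      have "l e \<le> r y'" unfolding l_def using fin_e[OF eE] y'(1) by simp
      then have "u \<noteq> y'" "u \<noteq> y" using u(2) y(2) by auto
      then have "u \<in> surround y y'" using u(1) by (simp add: surround_def)
      then have away: "card (near e - inc u) \<le> 54"
        unfolding y'(1) using y'(3) by (intro card_near_away) (simp_all add: nbrs_def)
      have "u \<notin> f" if f: "f \<in> X" for f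
      proof
        assume "u \<in> f"
        have "f \<in> E" using f X(1) by blast
        then have "l f \<le> r u" unfolding l_def using fin_e \<open>u \<in> f\<close> by simp
        moreover have "l e \<le> l f" using e(2) f finX by simp
        ultimately show False using u(2) y(2) by simp
      qed
      then have "T e \<subseteq> (near e - inc u) \<union> {f \<in> P. u \<in> f}"
        using T_near[of e] by (auto simp: T_def)
      then have "card (T e) \<le> card ((near e - inc u) \<union> {f \<in> P. u \<in> f})"
        using finite_E finP by (intro card_mono) simp_all
      also have "\<dots> \<le> 54 + 2"
        using card_Un_le[of "near e - inc u" "{f \<in> P. u \<in> f}"] away P2[of u] by linarith
      finally have "card (c' ` T e) \<le> 56" for c' :: "'a set \<Rightarrow> nat"
        using card_image_le[OF finT[of e], of c'] by simp
      then show ?thesis using e(1) by blast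
    qed
    then show "\<exists>e\<in>X. \<forall>c'. (\<forall>q\<in>P. c' q = p q) \<longrightarrow>
        card (c' ` ({f. conflict E e f} \<inter> (P \<union> X))) \<le> 56"
      by (simp add: T_def)
  qed
  then obtain c where "partial_coloring E (Suc 56) (P \<union> (E - P)) c" by blast
  moreover have "P \<union> (E - P) = E" using PE by blast
  ultimately show False using uncolorable[of c] by simp
qed

lemma center_plain:
  fixes s :: "'a \<Rightarrow> nat"
  assumes "v \<in> \<Union>E"
    and "\<And>x. x \<in> nb v \<Longrightarrow> card (near {v, x}) + s x \<le> 60"
    and "\<And>x. x \<in> nb v \<Longrightarrow> 4 \<le> s x + card {y \<in> nb v. s x < s y}"
  shows False
proof (rule center[where P = "{}" and p = "\<lambda>_. 0" and R = 0 and s = s, OF assms(1)])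
  show "partial_coloring E 57 {} (\<lambda>_. 0)" by (simp add: partial_coloring_def)
qed (use assms in simp_all)

text \<open>The instance of \<open>center\<close> in which \<open>P\<close> consists of the edges
  \<open>{x, h x}\<close> with \<open>x\<close> next to \<open>v\<close>; each of them conflicts
  with all other edges at \<open>x\<close> and with every edge at \<open>v\<close>. The colour
  \<open>q x\<close> is attached to the vertex \<open>x\<close>, \<open>same\<close> keeps edges of
  equal colour from conflicting, and \<open>mult\<close> controls shared tips.\<close>

lemma spokes:
  fixes s q :: "'a \<Rightarrow> nat"
  assumes v: "v \<in> \<Union>E" and S: "S \<subseteq> nb v"
    and h: "\<And>x. x \<in> S \<Longrightarrow> h x \<in> nb x" "\<And>x. x \<in> S \<Longrightarrow> h x \<noteq> v"
    and indep: "\<And>x y. x \<in> S \<Longrightarrow> y \<in> S \<Longrightarrow> x \<notin> nb y"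
    and same: "\<And>x y. x \<in> S \<Longrightarrow> y \<in> S \<Longrightarrow> x \<noteq> y \<Longrightarrow> q x = q y \<Longrightarrow>
      h x \<notin> nb y \<and> h x \<notin> nb (h y)"
    and q: "\<And>x. x \<in> S \<Longrightarrow> q x < 57"
    and mult: "\<And>w. card {x \<in> S. h x = w} \<le> 2"
    and R: "card (q ` S) + R \<le> card S"
    and slack: "\<And>x. x \<in> nb v \<Longrightarrow> card (near {v, x}) + s x \<le> 60"
    and enough: "\<And>x. x \<in> nb v \<Longrightarrow> 4 \<le> R + s x + card {y \<in> nb v. s x < s y}"
  shows False
proof -
  define g where "g x = {x, h x}" for x
  define p where "p = q \<circ> inv_into S g"
  have finS: "finite S" using S finite_subset finite_nb by blast
  \<comment> \<open>No tip lies in \<open>S\<close>, as \<open>S\<close> is independent. So each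
    edge determines its \<open>x\<close>, and a vertex of \<open>S\<close> lies on only one of the
    edges.\<close>
  have hS: "h x \<noteq> y" if "x \<in> S" "y \<in> S" for x y
    using h(1)[OF that(1)] indep[OF that(2,1)] by auto
  have inj: "inj_on g S"
    using hS by (auto simp: inj_on_def g_def doubleton_eq_iff)
  then have pg: "p (g x) = q x" if "x \<in> S" for x
    using that by (simp add: p_def)
  have "p ` g ` S = q ` S" unfolding image_image using pg by simp
  show False
  proof (rule center[where P = "g ` S" and p = p and R = R and s = s, OF v])
    fix x assume x: "x \<in> nb v"
    show "g ` S \<subseteq> near {v, x}"
    proof
      fix e assume "e \<in> g ` S"
      then obtain y where y: "y \<in> S" "e = g y" by blast
      have yv: "y \<in> nb v" using S y(1) by blast
      then have "v \<notin> e" using h(2)[OF y(1)] not_mem_nb_self y(2) by (auto simp: g_def)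
      then have "e \<noteq> {v, x}" by blast
      moreover have "e \<in> E" using h(1)[OF y(1)] y(2) by (simp add: g_def nbrs_def)
      ultimately show "e \<in> near {v, x}" using yv y(2) by (auto simp: conflict_def g_def nbrs_def)
    qed
  next
    show "partial_coloring E 57 (g ` S) p"
      unfolding partial_coloring_def
    proof (intro conjI ballI impI)
      fix e assume "e \<in> g ` S"
      then show "p e < 57" using pg q by auto
    next
      fix e f assume "e \<in> g ` S" "f \<in> g ` S" and con: "conflict E e f"
      then obtain x y where x: "x \<in> S" "e = g x" and y: "y \<in> S" "f = g y" by blast
      have "x \<noteq> y" using con x(2) y(2) by (auto simp: conflict_def)
      show "p e \<noteq> p f"
      proof
        assume "p e = p f"
        then have eq: "q x = q y" using x y pg by simp
        have 1: "h x \<notin> nb y" "h x \<notin> nb (h y)" "h y \<notin> nb x"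
          using same[OF x(1) y(1) \<open>x \<noteq> y\<close> eq] same[OF y(1) x(1)] \<open>x \<noteq> y\<close> eq by auto
        have "h x \<noteq> h y" using 1(1) h(1)[OF y(1)] by auto
        moreover have "x \<notin> nb y" using indep x(1) y(1) by blast
        ultimately show False
          using con 1 hS[OF x(1) y(1)] hS[OF y(1) x(1)] \<open>x \<noteq> y\<close>
          unfolding x(2) y(2) conflict_def g_def nbrs_def by (auto simp: insert_commute)
      qed
    qed
  next
    fix w
    have "card {e \<in> g ` S. w \<in> e} \<le> card (g ` {x \<in> S. x = w \<or> h x = w})"
      using finS by (intro card_mono) (auto simp: g_def)
    also have "\<dots> \<le> card {x \<in> S. x = w \<or> h x = w}" using finS by (simp add: card_image_le)
    also have "\<dots> \<le> 2"
    proof (cases "w \<in> S")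
      case True
      then have "{x \<in> S. x = w \<or> h x = w} = {w}" using hS by blast
      then show ?thesis by simp
    next
      case False
      then have "{x \<in> S. x = w \<or> h x = w} = {x \<in> S. h x = w}" by blast
      then show ?thesis using mult by simp
    qed
    finally show "card {e \<in> g ` S. w \<in> e} \<le> 2" .
  next
    show "card (p ` g ` S) + R \<le> card (g ` S)"
      using R \<open>p ` g ` S = q ` S\<close> by (simp add: card_image[OF inj])
  qed (use slack enough in auto)
qed

section \<open>Six-regularity and the first repeated colour\<close>

text \<open>At a vertex of degree at most 5 every edge has at most 54 conflicts, a slack of 6 where
  4 is enough.\<close>

lemma card_nb_eq:
  assumes "v \<in> \<Union>E"
  shows "card (nb v) = 6"
proof (rule ccontr)
  assume "card (nb v) \<noteq> 6"
  then have "card (nb v) \<le> 5" using card_nb_le[of v] by linarith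
  then have "card (near {v, x}) \<le> 54" if "x \<in> nb v" for x
    using that by (intro card_near_le_54 card_surround) (simp_all add: nbrs_def)
  then show False
    by (intro center_plain[OF assms, of "\<lambda>_. 6"]) fastforce+
qed

text \<open>The edges \<open>{x, a}\<close> and \<open>{y, b}\<close> can then share a colour: this
  is the source of all repetitions in pairs.\<close>

lemma nonadjacent_neighbours:
  assumes "x \<noteq> y" "y \<notin> nb x" "v \<in> nb x \<inter> nb y" "card (nb x \<inter> nb y) \<le> 3"
  shows "\<exists>a b. a \<in> nb x \<and> a \<notin> nb y \<and> b \<in> nb y \<and> b \<notin> nb x \<and> b \<notin> nb a"
proof (rule ccontr)
  assume none: "\<not> ?thesis"
  let ?Y = "nb x \<inter> nb y"
  \<comment> \<open>A complete bipartite graph between \<open>?B\<close> and \<open>?C\<close> puts many 4-cycles on the edges at \<open>x\<close>.\<close>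
  let ?B = "nb x - nb y" and ?C = "nb y - nb x"
  have full: "b \<in> nb a" if "a \<in> ?B" "b \<in> ?C" for a b
    using none that by blast
  have xE: "x \<in> \<Union>E" and yE: "y \<in> \<Union>E" using assms(3) by (auto simp: nbrs_def)
  have k: "1 \<le> card ?Y"
    using assms(3) by (metis One_nat_def Suc_leI card_gt_0_iff empty_iff finite_Int finite_nb)
  have B: "card ?B = 6 - card ?Y" and C: "card ?C = 6 - card ?Y"
    using card_nb_eq[OF xE] card_nb_eq[OF yE] by (simp_all add: card_Diff_subset_Int Int_commute)
  \<comment> \<open>Slack 4 on the edges to \<open>?B\<close>, from at least 2 * 2 edges between
    \<open>?B - {z}\<close> and \<open>?C\<close>; slack \<open>card ?Y - 1\<close> on the others,
    from 4-cycles through \<open>y\<close>. The former come last, so the latter reach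
    (\<open>card ?Y\<close> - 1) + (6 - \<open>card ?Y\<close>) = 5.\<close>
  define s where "s z = (if z \<in> ?B then 4 else card ?Y - 1)" for z
  show False
  proof (rule center_plain[OF xE, of s])
    fix z assume z: "z \<in> nb x"
    show "card (near {x, z}) + s z \<le> 60"
    proof (cases "z \<in> ?B")
      case False
      then show ?thesis using card_common_plus[OF assms(1), of z "{}"] z by (simp add: s_def)
    next
      case True
      let ?F = "(\<lambda>(a, b). {a, b}) ` ((?B - {z}) \<times> ?C)"
      have F: "\<exists>a b. f = {a, b} \<and> a \<in> ?B \<and> a \<noteq> z \<and> b \<in> ?C" if "f \<in> ?F" for f
        using that by (elim imageE SigmaE) auto
      have "card (near {x, z}) + card ?F \<le> 60"
      proof (rule card_near_plus)
        show "adj x z" using z by (simp add: nbrs_def)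
        show "?F \<subseteq> E"
        proof
          fix f assume "f \<in> ?F"
          then obtain a b where "f = {a, b}" "a \<in> ?B" "b \<in> ?C" using F by meson
          moreover from this have "b \<in> nb a" by (intro full)
          ultimately show "f \<in> E" by (simp add: nbrs_def)
        qed
        fix f assume "f \<in> ?F"
        then obtain a b where ab: "f = {a, b}" "a \<in> ?B" "a \<noteq> z" "b \<in> ?C" using F by meson
        have "b \<in> nb z" using full[OF True ab(4)] .
        moreover have "b \<noteq> x" using ab(4) assms(2) mem_nbrs_sym[of x E y] by auto
        moreover have "a \<noteq> x" using ab(2) not_mem_nb_self by auto
        ultimately show "f \<subseteq> surround x z"
          using ab True not_mem_nb_self by (auto simp: surround_def)
      qed
      moreover have "card ?F = card (?B - {z}) * card ?C"
      proof -
        have "inj_on (\<lambda>(a, b). {a, b}) ((?B - {z}) \<times> ?C)"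
          by (auto simp: inj_on_def doubleton_eq_iff)
        then show ?thesis by (simp add: card_image card_cartesian_product)
      qed
      moreover have "4 \<le> card (?B - {z}) * card ?C"
      proof -
        have "card (?B - {z}) = 5 - card ?Y" using True B by simp
        then have "2 \<le> card (?B - {z})" "2 \<le> card ?C" using C assms(4) by linarith+
        then show ?thesis using mult_le_mono by fastforce
      qed
      ultimately show ?thesis using True by (simp add: s_def)
    qed
    show "4 \<le> s z + card {t \<in> nb x. s z < s t}"
    proof (cases "z \<in> ?B")
      case True
      then show ?thesis by (simp add: s_def)
    next
      case False
      then have "?B \<subseteq> {t \<in> nb x. s z < s t}" using assms(4) by (auto simp: s_def)
      then have "card ?B \<le> card {t \<in> nb x. s z < s t}" by (intro card_mono) simp_all
      moreover have "s z = card ?Y - 1" using False by (auto simp: s_def)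
      ultimately show ?thesis using B k assms(4) by linarith
    qed
  qed
qed

lemma card_near_le_60:
  assumes "x \<in> nb v"
  shows "card (near {v, x}) \<le> 60"
  using card_near_plus[of v x "{}"] assms by (simp add: nbrs_def)

lemma mem_Union_of_nb: "x \<in> nb v \<Longrightarrow> v \<in> \<Union>E"
  by (auto simp: nbrs_def)

text \<open>One repeated colour, on the two edges that \<open>nonadjacent_neighbours\<close>
  provides at \<open>z\<close> and \<open>z'\<close>, lowers the demand on every edge at
  \<open>v\<close> from 4 to 3.\<close>

lemma center_pair:
  fixes s :: "'a \<Rightarrow> nat"
  assumes z: "z \<in> nb v" "z' \<in> nb v" "z \<noteq> z'" "z' \<notin> nb z" "card (nb z \<inter> nb z') \<le> 3"
    and slack: "\<And>x. x \<in> nb v \<Longrightarrow> card (near {v, x}) + s x \<le> 60"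
    and enough: "\<And>x. x \<in> nb v \<Longrightarrow> 4 \<le> 1 + s x + card {y \<in> nb v. s x < s y}"
  shows False
proof -
  have vz: "v \<in> nb z \<inter> nb z'" using z(1,2) mem_nbrs_sym by fast
  obtain a b where ab: "a \<in> nb z" "a \<notin> nb z'" "b \<in> nb z'" "b \<notin> nb z" "b \<notin> nb a"
    using nonadjacent_neighbours[OF z(3,4) vz z(5)] by blast
  have ne: "a \<noteq> v" "b \<noteq> v" using ab vz by auto
  have sym: "a \<notin> nb b" "z \<notin> nb z'" using ab(5) z(4) mem_nbrs_sym by fast+
  show False
  proof (rule spokes[where S = "{z, z'}" and h = "\<lambda>x. if x = z then a else b"
        and q = "\<lambda>_. 0" and R = 1 and s = s])
    show "v \<in> \<Union>E" using z(1) by (rule mem_Union_of_nb)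
    show "card {x \<in> {z, z'}. (if x = z then a else b) = w} \<le> 2" for w
    proof -
      have "card {x \<in> {z, z'}. (if x = z then a else b) = w} \<le> card {z, z'}"
        by (rule card_mono) auto
      then show ?thesis using z(3) by simp
    qed
  qed (use z ab ne sym slack enough not_mem_nb_self in \<open>auto split: if_splits\<close>)
qed

section \<open>Excluding triangles\<close>

text \<open>On a triangle v, u, w the edges from \<open>v\<close> to \<open>u\<close> and
  \<open>w\<close> have slack 6, and \<open>{u, w}\<close> gives slack 1 to the other four edges at
  \<open>v\<close>. With two later edges these reach 3 of the required 4. The missing unit comes
  from an edge \<open>{v, x0}\<close> of slack 2, coloured after the other three, or, if there is
  none, from a repeated colour.\<close>

lemma triangle_free:
  assumes "u \<in> nb v"
  shows "nb u \<inter> nb v = {}"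
proof (rule ccontr)
  have vE: "v \<in> \<Union>E" using assms by (rule mem_Union_of_nb)
  assume "nb u \<inter> nb v \<noteq> {}"
  then obtain w where w: "w \<in> nb u" "w \<in> nb v" by blast
  have uw: "u \<noteq> w" "u \<in> nb w" using w not_mem_nb_self mem_nbrs_sym by (fast, fast)
  have tri: "card (near {v, x}) \<le> 54" if "x \<in> nb v" "y \<in> nb x" "y \<in> nb v" for x y
    using that by (intro card_near_le_54 card_surround(2)) (auto simp: nbrs_def)
  let ?X = "nb v - {u, w}"
  have X: "card ?X = 4" using card_nb_eq[OF vE] assms w uw(1) by (simp add: card_Diff_subset)
  have uw_edge: "{u, w} \<in> E" using w(1) by (simp add: nbrs_def)
  have uw_surround: "{u, w} \<subseteq> surround v x" if "x \<in> ?X" for x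
    using that assms w not_mem_nb_self by (auto simp: surround_def)
  have slack1: "card (near {v, x}) + 1 \<le> 60" if "x \<in> ?X" for x
    using card_near_plus[of v x "{{u, w}}"] uw_edge uw_surround[OF that] that
    by (simp add: nbrs_def)
  show False
  proof (cases "\<exists>x\<in>?X. card (near {v, x}) \<le> 58")
    case True
    then obtain x0 where x0: "x0 \<in> ?X" "card (near {v, x0}) \<le> 58" by blast
    define s :: "'a \<Rightarrow> nat" where "s z = (if z \<in> {u, w} then 6 else if z = x0 then 2 else 1)" for z
    show False
    proof (rule center_plain[OF vE, of s])
      fix z assume z: "z \<in> nb v"
      show "card (near {v, z}) + s z \<le> 60"
        using z tri[OF assms w] tri[OF w(2) uw(2) assms] x0 slack1[of z] by (auto simp: s_def)
      consider "z \<in> {u, w}" | "z = x0" | "z \<notin> {u, w}" "z \<noteq> x0" by blast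
      then show "4 \<le> s z + card {t \<in> nb v. s z < s t}"
      proof cases
        case 2
        then have "{u, w} \<subseteq> {t \<in> nb v. s z < s t}" using assms w x0 by (auto simp: s_def)
        then have "card {u, w} \<le> card {t \<in> nb v. s z < s t}" by (intro card_mono) simp_all
        moreover have "s z = 2" using 2 x0 by (simp add: s_def)
        ultimately show ?thesis using uw(1) by simp
      next
        case 3
        then have "{u, w, x0} \<subseteq> {t \<in> nb v. s z < s t}" using assms w x0 by (auto simp: s_def)
        then have "card {u, w, x0} \<le> card {t \<in> nb v. s z < s t}" by (intro card_mono) simp_all
        moreover have "s z = 1" using 3 by (simp add: s_def)
        moreover have "card {u, w, x0} = 3" using x0 uw(1) by auto
        ultimately show ?thesis by linarith
      qed (simp add: s_def)
    qed
  next
    case False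
    \<comment> \<open>All four edges to \<open>?X\<close> now have at least 59 conflicts. This
      forbids further triangles and 4-cycles through them, so \<open>x\<close> and \<open>y\<close>
      are nonadjacent and have only \<open>v\<close> in common.\<close>
    have "2 \<le> card ?X" using X by simp
    then obtain xs where "distinct xs" "length xs = 2" "set xs \<subseteq> ?X" by (rule obtain_distinct)
    then obtain x y where xy: "x \<in> ?X" "y \<in> ?X" "x \<noteq> y"
      by (auto simp: length_Suc_conv numeral_eq_Suc)
    have "y \<notin> nb x" using tri[of x y] False xy by force
    moreover have "nb x \<inter> nb y \<subseteq> {v}"
    proof (rule ccontr)
      assume "\<not> nb x \<inter> nb y \<subseteq> {v}"
      then obtain t where t: "t \<in> nb x" "t \<in> nb y" "t \<noteq> v" by blast
      have "card (near {v, x}) + card {{u, w}, {y, t}} \<le> 60"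
      proof (rule card_near_plus)
        show "adj v x" "{{u, w}, {y, t}} \<subseteq> E" using xy(1) t(2) uw_edge by (auto simp: nbrs_def)
        have "{y, t} \<subseteq> surround v x"
          using t xy not_mem_nb_self by (auto simp: surround_def)
        then show "f \<subseteq> surround v x" if "f \<in> {{u, w}, {y, t}}" for f
          using that uw_surround[OF xy(1)] by blast
      qed
      moreover have "{u, w} \<noteq> {y, t}" using xy(2) by blast
      ultimately show False using False xy(1) by force
    qed
    then have "card (nb x \<inter> nb y) \<le> 3" using card_mono[of "{v}" "nb x \<inter> nb y"] by simp
    define s :: "'a \<Rightarrow> nat" where "s z = (if z \<in> {u, w} then 6 else 1)" for z
    show False
    proof (rule center_pair[of x v y s])
      fix z assume z: "z \<in> nb v"
      show "card (near {v, z}) + s z \<le> 60"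
        using z tri[OF assms w] tri[OF w(2) uw(2) assms] slack1[of z] by (auto simp: s_def)
      show "4 \<le> 1 + s z + card {t \<in> nb v. s z < s t}"
      proof (cases "z \<in> {u, w}")
        case False
        then have "{u, w} \<subseteq> {t \<in> nb v. s z < s t}" using assms w by (auto simp: s_def)
        then have "card {u, w} \<le> card {t \<in> nb v. s z < s t}" by (intro card_mono) simp_all
        moreover have "s z = 1" using False by (simp add: s_def)
        ultimately show ?thesis using uw(1) by simp
      qed (simp add: s_def)
    qed (use xy \<open>y \<notin> nb x\<close> \<open>card (nb x \<inter> nb y) \<le> 3\<close> in auto)
  qed
qed

lemma neighbours_nonadjacent: "x \<in> nb v \<Longrightarrow> y \<in> nb v \<Longrightarrow> x \<notin> nb y"
  using triangle_free[of y v] by blast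

section \<open>Excluding 4-cycles: at most 3, then 2, then 1 common neighbours\<close>

text \<open>At \<open>x\<close>, the edges to four or more common neighbours have slack 3 and are
  four later edges for the rest. The one unit they lack comes from an edge of slack 4 placed last,
  or from a repeated colour.\<close>

lemma card_common_le_3:
  assumes "x \<noteq> y"
  shows "card (nb x \<inter> nb y) \<le> 3"
proof (rule ccontr)
  let ?Y = "nb x \<inter> nb y"
  assume "\<not> card ?Y \<le> 3"
  then have Y: "4 \<le> card ?Y" by simp
  then have "2 \<le> card ?Y" by simp
  then obtain xs where "distinct xs" "length xs = 2" "set xs \<subseteq> ?Y" by (rule obtain_distinct)
  then obtain z z' where z: "z \<in> ?Y" "z' \<in> ?Y" "z \<noteq> z'"
    by (auto simp: length_Suc_conv numeral_eq_Suc)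
  have xE: "x \<in> \<Union>E" using z(1) mem_Union_of_nb by blast
  have slack3: "card (near {x, t}) + 3 \<le> 60" if "t \<in> ?Y" for t
    using card_common_plus[OF assms that, of "{}"] Y by simp
  show False
  proof (cases "\<exists>t\<in>?Y. card (near {x, t}) \<le> 56")
    case True
    then obtain t0 where t0: "t0 \<in> ?Y" "card (near {x, t0}) \<le> 56" by blast
    define s :: "'a \<Rightarrow> nat" where "s t = (if t = t0 then 4 else if t \<in> ?Y then 3 else 0)" for t
    show False
    proof (rule center_plain[OF xE, of s])
      fix t assume t: "t \<in> nb x"
      show "card (near {x, t}) + s t \<le> 60"
        using t0 slack3[of t] card_near_le_60[OF t] by (auto simp: s_def)
      consider "t = t0" | "t \<noteq> t0" "t \<in> ?Y" | "t \<notin> ?Y" by blast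
      then show "4 \<le> s t + card {r \<in> nb x. s t < s r}"
      proof cases
        case 2
        then have "{t0} \<subseteq> {r \<in> nb x. s t < s r}" using t0 by (auto simp: s_def)
        then have "card {t0} \<le> card {r \<in> nb x. s t < s r}" by (intro card_mono) simp_all
        then show ?thesis using 2 by (simp add: s_def)
      next
        case 3
        then have "?Y \<subseteq> {r \<in> nb x. s t < s r}" using t0 by (auto simp: s_def)
        then have "card ?Y \<le> card {r \<in> nb x. s t < s r}" by (intro card_mono) simp_all
        then show ?thesis using Y by simp
      qed (simp add: s_def)
    qed
  next
    case False
    \<comment> \<open>A third common neighbour \<open>q\<close> of \<open>z\<close> and
      \<open>z'\<close> would make \<open>{z', q}\<close> a fourth unit of slack for
      \<open>{x, z}\<close>.\<close>
    have "nb z \<inter> nb z' \<subseteq> {x, y}"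
    proof
      fix q assume q: "q \<in> nb z \<inter> nb z'"
      show "q \<in> {x, y}"
      proof (rule ccontr)
        assume qxy: "q \<notin> {x, y}"
        have "card (near {x, z}) + (card ?Y - 1) + card {{z', q}} \<le> 60"
        proof (rule card_common_plus[OF assms z(1)])
          show "{{z', q}} \<subseteq> E" using q by (simp add: nbrs_def)
          show "f \<subseteq> surround x z \<and> y \<notin> f" if "f \<in> {{z', q}}" for f
            using that q qxy z not_mem_nb_self by (auto simp: surround_def)
        qed
        then show False using False z(1) Y by force
      qed
    qed
    then have "card (nb z \<inter> nb z') \<le> card {x, y}" by (intro card_mono) simp_all
    then have "card (nb z \<inter> nb z') \<le> 3" using assms by simp
    define s :: "'a \<Rightarrow> nat" where "s t = (if t \<in> ?Y then 3 else 0)" for t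
    show False
    proof (rule center_pair[of z x z' s])
      show "z' \<notin> nb z" using neighbours_nonadjacent[of z' x z] z by blast
      fix t assume t: "t \<in> nb x"
      show "card (near {x, t}) + s t \<le> 60"
        using slack3[of t] card_near_le_60[OF t] by (auto simp: s_def)
      show "4 \<le> 1 + s t + card {r \<in> nb x. s t < s r}"
      proof (cases "t \<in> ?Y")
        case False
        then have "?Y \<subseteq> {r \<in> nb x. s t < s r}" by (auto simp: s_def)
        then have "card ?Y \<le> card {r \<in> nb x. s t < s r}" by (intro card_mono) simp_all
        then show ?thesis using Y by simp
      qed (simp add: s_def)
    qed (use z \<open>card (nb z \<inter> nb z') \<le> 3\<close> in auto)
  qed
qed

lemma nonconflicting_pair:
  assumes "x \<in> nb v" "y \<in> nb v" "x \<noteq> y"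
  shows "\<exists>a b. a \<in> nb x - {v} \<and> b \<in> nb y - {v} \<and> a \<notin> nb y \<and> b \<notin> nb x \<and> b \<notin> nb a \<and> a \<notin> nb b"
proof -
  have v: "v \<in> nb x \<inter> nb y" using assms(1,2) mem_nbrs_sym by fast
  obtain a b where "a \<in> nb x" "a \<notin> nb y" "b \<in> nb y" "b \<notin> nb x" "b \<notin> nb a"
    using nonadjacent_neighbours[OF assms(3) neighbours_nonadjacent[OF assms(2,1)] v
      card_common_le_3[OF assms(3)]] by blast
  moreover from this have "a \<notin> nb b" using mem_nbrs_sym by fast
  ultimately show ?thesis using v by blast
qed

text \<open>Two colours, each on a pair of edges, give two repetitions. Edges to the three or more
  common neighbours add slack 2; the others have three later edges.\<close>

lemma card_common_le_2:
  assumes "x \<noteq> y"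
  shows "card (nb x \<inter> nb y) \<le> 2"
proof (rule ccontr)
  let ?Y = "nb x \<inter> nb y"
  assume "\<not> card ?Y \<le> 2"
  then have Y: "3 \<le> card ?Y" by simp
  then have "?Y \<noteq> {}" by fastforce
  then have xE: "x \<in> \<Union>E" using mem_Union_of_nb by blast
  have "4 \<le> card (nb x)" using card_nb_eq[OF xE] by simp
  then obtain xs where xs: "distinct xs" "length xs = 4" "set xs \<subseteq> nb x" by (rule obtain_distinct)
  obtain x1 x2 x3 x4 where "xs = [x1, x2, x3, x4]"
    using xs(2) by (auto simp: length_Suc_conv numeral_eq_Suc)
  then have dist: "distinct [x1, x2, x3, x4]" and
    nb: "x1 \<in> nb x" "x2 \<in> nb x" "x3 \<in> nb x" "x4 \<in> nb x" using xs by simp_all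
  obtain a1 a2 where a: "a1 \<in> nb x1 - {x}" "a2 \<in> nb x2 - {x}" "a1 \<notin> nb x2" "a2 \<notin> nb x1"
      "a2 \<notin> nb a1" "a1 \<notin> nb a2"
    using nonconflicting_pair[OF nb(1,2)] dist by auto
  obtain a3 a4 where b: "a3 \<in> nb x3 - {x}" "a4 \<in> nb x4 - {x}" "a3 \<notin> nb x4" "a4 \<notin> nb x3"
      "a4 \<notin> nb a3" "a3 \<notin> nb a4"
    using nonconflicting_pair[OF nb(3,4)] dist by auto
  define h where "h = (\<lambda>_. x)(x1 := a1, x2 := a2, x3 := a3, x4 := a4)"
  define q :: "'a \<Rightarrow> nat" where "q t = (if t \<in> {x1, x2} then 0 else 1)" for t
  define s :: "'a \<Rightarrow> nat" where "s t = (if t \<in> ?Y then 2 else 0)" for t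
  have h: "h x1 = a1" "h x2 = a2" "h x3 = a3" "h x4 = a4" using dist by (simp_all add: h_def)
  have q: "q x1 = 0" "q x2 = 0" "q x3 = 1" "q x4 = 1" using dist by (auto simp: q_def)
  let ?S = "{x1, x2, x3, x4}"
  show False
  proof (rule spokes[where S = ?S and h = h and q = q and R = 2 and s = s, OF xE])
    show "?S \<subseteq> nb x" using nb by simp
    then show "t \<notin> nb r" if "t \<in> ?S" "r \<in> ?S" for t r
      using neighbours_nonadjacent that by blast
    show "h t \<in> nb t" "h t \<noteq> x" if "t \<in> ?S" for t using that a b h by auto
    show "h t \<notin> nb r \<and> h t \<notin> nb (h r)" if "t \<in> ?S" "r \<in> ?S" "t \<noteq> r" "q t = q r" for t r
      using that a b h q by auto
    show "q t < 57" for t by (simp add: q_def)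
    show "card {t \<in> ?S. h t = w} \<le> 2" for w
    proof -
      \<comment> \<open>Tips of equal colour differ, so \<open>w\<close> is the tip of at most one
        edge of each colour.\<close>
      have "a1 \<noteq> a2" "a3 \<noteq> a4" using a b by auto
      then have "{t \<in> ?S. h t = w} \<subseteq> {if a1 = w then x1 else x2, if a3 = w then x3 else x4}"
        using h by auto
      then have "card {t \<in> ?S. h t = w} \<le> card {if a1 = w then x1 else x2, if a3 = w then x3 else x4}"
        by (intro card_mono) simp_all
      also have "\<dots> \<le> 2" by (simp add: card_insert_if)
      finally show ?thesis .
    qed
    have "q ` ?S \<subseteq> {0, 1}" by (auto simp: q_def)
    then have "card (q ` ?S) \<le> card {0, 1 :: nat}" by (intro card_mono) simp_all
    then show "card (q ` ?S) + 2 \<le> card ?S" using dist by simp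
    fix t assume t: "t \<in> nb x"
    show "card (near {x, t}) + s t \<le> 60"
      using card_common_plus[OF assms, of t "{}"] card_near_le_60[OF t] Y by (auto simp: s_def)
    show "4 \<le> 2 + s t + card {r \<in> nb x. s t < s r}"
    proof (cases "t \<in> ?Y")
      case False
      then have "?Y \<subseteq> {r \<in> nb x. s t < s r}" by (auto simp: s_def)
      then have "card ?Y \<le> card {r \<in> nb x. s t < s r}" by (intro card_mono) simp_all
      then show ?thesis using Y by simp
    qed (simp add: s_def)
  qed
qed

text \<open>With three colours, counting colours no longer bounds shared tips by 2. Instead, all
  \<open>t\<close> with tip \<open>w\<close> are common neighbours of \<open>v\<close> and
  \<open>w\<close>.\<close>

lemma card_tips_le:
  assumes "\<And>t. t \<in> S \<Longrightarrow> h t \<in> nb t" "\<And>t. t \<in> S \<Longrightarrow> h t \<noteq> v" "S \<subseteq> nb v"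
  shows "card {t \<in> S. h t = w} \<le> 2"
proof (cases "w = v")
  case True
  then have "{t \<in> S. h t = w} = {}" using assms(2) by blast
  then show ?thesis by (metis card.empty zero_le)
next
  case False
  have "{t \<in> S. h t = w} \<subseteq> nb v \<inter> nb w" using assms(1,3) mem_nbrs_sym by fast
  then have "card {t \<in> S. h t = w} \<le> card (nb v \<inter> nb w)" by (intro card_mono) simp_all
  then show ?thesis using card_common_le_2[of v w] False by simp
qed

text \<open>The six neighbours form three pairs, hence three repetitions. Slack 1 completes the
  edges to common neighbours, and the other edges have at least two later ones.\<close>

lemma card_common_le_1:
  assumes "x \<noteq> y"
  shows "card (nb x \<inter> nb y) \<le> 1"
proof (rule ccontr)
  let ?Y = "nb x \<inter> nb y"
  assume "\<not> card ?Y \<le> 1"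
  then have Y: "2 \<le> card ?Y" by simp
  then have "?Y \<noteq> {}" by fastforce
  then have xE: "x \<in> \<Union>E" using mem_Union_of_nb by blast
  have "6 \<le> card (nb x)" using card_nb_eq[OF xE] by simp
  then obtain xs where xs: "distinct xs" "length xs = 6" "set xs \<subseteq> nb x" by (rule obtain_distinct)
  obtain x1 x2 x3 x4 x5 x6 where "xs = [x1, x2, x3, x4, x5, x6]"
    using xs(2) by (auto simp: length_Suc_conv numeral_eq_Suc)
  then have dist: "distinct [x1, x2, x3, x4, x5, x6]" and
    nb: "x1 \<in> nb x" "x2 \<in> nb x" "x3 \<in> nb x" "x4 \<in> nb x" "x5 \<in> nb x" "x6 \<in> nb x"
    using xs by simp_all
  obtain a1 a2 where a: "a1 \<in> nb x1 - {x}" "a2 \<in> nb x2 - {x}" "a1 \<notin> nb x2" "a2 \<notin> nb x1"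
      "a2 \<notin> nb a1" "a1 \<notin> nb a2"
    using nonconflicting_pair[OF nb(1,2)] dist by auto
  obtain a3 a4 where b: "a3 \<in> nb x3 - {x}" "a4 \<in> nb x4 - {x}" "a3 \<notin> nb x4" "a4 \<notin> nb x3"
      "a4 \<notin> nb a3" "a3 \<notin> nb a4"
    using nonconflicting_pair[OF nb(3,4)] dist by auto
  obtain a5 a6 where c: "a5 \<in> nb x5 - {x}" "a6 \<in> nb x6 - {x}" "a5 \<notin> nb x6" "a6 \<notin> nb x5"
      "a6 \<notin> nb a5" "a5 \<notin> nb a6"
    using nonconflicting_pair[OF nb(5,6)] dist by auto
  define h where "h = (\<lambda>_. x)(x1 := a1, x2 := a2, x3 := a3, x4 := a4, x5 := a5, x6 := a6)"
  define q :: "'a \<Rightarrow> nat" where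
    "q t = (if t \<in> {x1, x2} then 0 else if t \<in> {x3, x4} then 1 else 2)" for t
  define s :: "'a \<Rightarrow> nat" where "s t = (if t \<in> ?Y then 1 else 0)" for t
  have h: "h x1 = a1" "h x2 = a2" "h x3 = a3" "h x4 = a4" "h x5 = a5" "h x6 = a6"
    using dist by (simp_all add: h_def)
  have q: "q x1 = 0" "q x2 = 0" "q x3 = 1" "q x4 = 1" "q x5 = 2" "q x6 = 2"
    using dist by (auto simp: q_def)
  let ?S = "{x1, x2, x3, x4, x5, x6}"
  have S: "?S \<subseteq> nb x" using nb by simp
  have hS: "h t \<in> nb t" "h t \<noteq> x" if "t \<in> ?S" for t using that a b c h by auto
  show False
  proof (rule spokes[where S = ?S and h = h and q = q and R = 3 and s = s, OF xE S hS])
    show "t \<notin> nb r" if "t \<in> ?S" "r \<in> ?S" for t r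
      using neighbours_nonadjacent that S by blast
    show "h t \<notin> nb r \<and> h t \<notin> nb (h r)" if "t \<in> ?S" "r \<in> ?S" "t \<noteq> r" "q t = q r" for t r
      using that a b c h q by auto
    show "q t < 57" for t by (simp add: q_def)
    show "card {t \<in> ?S. h t = w} \<le> 2" for w by (rule card_tips_le[OF hS S])
    have "q ` ?S \<subseteq> {0, 1, 2}" by (auto simp: q_def)
    then have "card (q ` ?S) \<le> card {0, 1, 2 :: nat}" by (intro card_mono) simp_all
    then show "card (q ` ?S) + 3 \<le> card ?S" using dist by simp
    fix t assume t: "t \<in> nb x"
    show "card (near {x, t}) + s t \<le> 60"
      using card_common_plus[OF assms, of t "{}"] card_near_le_60[OF t] Y by (auto simp: s_def)
    show "4 \<le> 3 + s t + card {r \<in> nb x. s t < s r}"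
    proof (cases "t \<in> ?Y")
      case False
      then have "?Y \<subseteq> {r \<in> nb x. s t < s r}" by (auto simp: s_def)
      then have "card ?Y \<le> card {r \<in> nb x. s t < s r}" by (intro card_mono) simp_all
      then show ?thesis using Y by simp
    qed (simp add: s_def)
  qed simp_all
qed

section \<open>Graphs without triangles and 4-cycles\<close>

text \<open>The ends are chosen one after another. Distinct vertices have at most one common
  neighbour, so among the six neighbours of \<open>y\<close> only \<open>v\<close> and at most two
  more are excluded.\<close>

lemma nonconflicting_triple:
  assumes x: "x1 \<in> nb v" "x2 \<in> nb v" "x3 \<in> nb v"
  shows "\<exists>a1 a2 a3. a1 \<in> nb x1 - {v} \<and> a2 \<in> nb x2 - {v} \<and> a3 \<in> nb x3 - {v} \<and>
    a1 \<notin> nb a2 \<and> a2 \<notin> nb a1 \<and> a1 \<notin> nb a3 \<and> a3 \<notin> nb a1 \<and> a2 \<notin> nb a3 \<and> a3 \<notin> nb a2"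
proof -
  have avoid: "\<exists>a\<in>nb y - {v}. a \<notin> nb b \<and> a \<notin> nb c" if "y \<in> nb v" "b \<noteq> y" "c \<noteq> y" for y b c
  proof (rule ccontr)
    assume "\<not> ?thesis"
    then have "nb y \<subseteq> {v} \<union> (nb y \<inter> nb b) \<union> (nb y \<inter> nb c)" by blast
    then have "card (nb y) \<le> card ({v} \<union> (nb y \<inter> nb b) \<union> (nb y \<inter> nb c))"
      by (intro card_mono) simp_all
    also have "\<dots> \<le> card {v} + card (nb y \<inter> nb b) + card (nb y \<inter> nb c)"
      by (meson add_le_mono1 card_Un_le le_trans)
    also have "\<dots> \<le> 3" using card_common_le_1[of y b] card_common_le_1[of y c] that(2,3) by simp
    finally have "card (nb y) \<le> 3" .
    moreover have "v \<in> nb y" using that(1) mem_nbrs_sym by fast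
    then have "card (nb y) = 6" using card_nb_eq mem_Union_of_nb by blast
    ultimately show False by simp
  qed
  \<comment> \<open>\<open>avoid\<close> needs the earlier ends to differ from the next
    \<open>y\<close>. Neighbours of \<open>v\<close> are pairwise nonadjacent, so no chosen end is
    itself a neighbour of \<open>v\<close>.\<close>
  have far: "a \<noteq> y" if "a \<in> nb x'" "x' \<in> nb v" "y \<in> nb v" for a x' y
    using neighbours_nonadjacent[OF that(3,2)] that(1) by blast
  have "v \<noteq> x1" using x(1) not_mem_nb_self by blast
  then obtain a1 where a1: "a1 \<in> nb x1 - {v}" using avoid[OF x(1), of v v] by blast
  then have "a1 \<noteq> x2" "a1 \<noteq> x3" using far x by blast+
  then obtain a2 where a2: "a2 \<in> nb x2 - {v}" "a2 \<notin> nb a1" using avoid[OF x(2), of a1 a1] by blast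
  then have "a2 \<noteq> x3" using far x by blast
  then obtain a3 where a3: "a3 \<in> nb x3 - {v}" "a3 \<notin> nb a1" "a3 \<notin> nb a2"
    using avoid[OF x(3) \<open>a1 \<noteq> x3\<close>] by blast
  then have "a1 \<notin> nb a2" "a1 \<notin> nb a3" "a2 \<notin> nb a3" using a2(2) mem_nbrs_sym by fast+
  then show ?thesis using a1 a2 a3 by blast
qed

lemma no_critical_graph: False
proof -
  have "E \<noteq> {}" using uncolorable[of "\<lambda>_. 0"] by (auto simp: partial_coloring_def)
  then obtain e where "e \<in> E" by blast
  then obtain x y where "e = {x, y}" by (rule edge_cases)
  then have xE: "x \<in> \<Union>E" using \<open>e \<in> E\<close> by blast
  have "6 \<le> card (nb x)" using card_nb_eq[OF xE] by simp
  then obtain xs where xs: "distinct xs" "length xs = 6" "set xs \<subseteq> nb x" by (rule obtain_distinct)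
  obtain x1 x2 x3 x4 x5 x6 where "xs = [x1, x2, x3, x4, x5, x6]"
    using xs(2) by (auto simp: length_Suc_conv numeral_eq_Suc)
  then have dist: "distinct [x1, x2, x3, x4, x5, x6]" and
    nb: "x1 \<in> nb x" "x2 \<in> nb x" "x3 \<in> nb x" "x4 \<in> nb x" "x5 \<in> nb x" "x6 \<in> nb x"
    using xs by simp_all
  obtain a1 a2 a3 where a: "a1 \<in> nb x1 - {x}" "a2 \<in> nb x2 - {x}" "a3 \<in> nb x3 - {x}"
      "a1 \<notin> nb a2" "a2 \<notin> nb a1" "a1 \<notin> nb a3" "a3 \<notin> nb a1" "a2 \<notin> nb a3" "a3 \<notin> nb a2"
    using nonconflicting_triple[OF nb(1-3)] by blast
  obtain a4 a5 a6 where b: "a4 \<in> nb x4 - {x}" "a5 \<in> nb x5 - {x}" "a6 \<in> nb x6 - {x}"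
      "a4 \<notin> nb a5" "a5 \<notin> nb a4" "a4 \<notin> nb a6" "a6 \<notin> nb a4" "a5 \<notin> nb a6" "a6 \<notin> nb a5"
    using nonconflicting_triple[OF nb(4-6)] by blast
  define h where "h = (\<lambda>_. x)(x1 := a1, x2 := a2, x3 := a3, x4 := a4, x5 := a5, x6 := a6)"
  define q :: "'a \<Rightarrow> nat" where "q t = (if t \<in> {x1, x2, x3} then 0 else 1)" for t
  have h: "h x1 = a1" "h x2 = a2" "h x3 = a3" "h x4 = a4" "h x5 = a5" "h x6 = a6"
    using dist by (simp_all add: h_def)
  have q: "q x1 = 0" "q x2 = 0" "q x3 = 0" "q x4 = 1" "q x5 = 1" "q x6 = 1"
    using dist by (auto simp: q_def)
  let ?S = "{x1, x2, x3, x4, x5, x6}"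
  have S: "?S \<subseteq> nb x" using nb by simp
  have hS: "h t \<in> nb t" "h t \<noteq> x" if "t \<in> ?S" for t using that a b h by auto
  show False
  proof (rule spokes[where S = ?S and h = h and q = q and R = 4 and s = "\<lambda>_. 0", OF xE S hS])
    show "t \<notin> nb r" if "t \<in> ?S" "r \<in> ?S" for t r
      using neighbours_nonadjacent that S by blast
    show "h t \<notin> nb r \<and> h t \<notin> nb (h r)" if "t \<in> ?S" "r \<in> ?S" "t \<noteq> r" "q t = q r" for t r
    proof
      show "h t \<notin> nb (h r)" using that a b h q by auto
      \<comment> \<open>A tip adjacent to \<open>r\<close> would close the 4-cycle x, t, h t,
        r.\<close>
      show "h t \<notin> nb r"
      proof
        assume "h t \<in> nb r"
        then have "{x, h t} \<subseteq> nb t \<inter> nb r" using hS[OF that(1)] that(1,2) S mem_nbrs_sym by fast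
        then have "card {x, h t} \<le> card (nb t \<inter> nb r)" by (intro card_mono) simp_all
        then show False using card_common_le_1[OF that(3)] hS(2)[OF that(1)] by simp
      qed
    qed
    show "q t < 57" for t by (simp add: q_def)
    show "card {t \<in> ?S. h t = w} \<le> 2" for w by (rule card_tips_le[OF hS S])
    have "q ` ?S \<subseteq> {0, 1}" by (auto simp: q_def)
    then have "card (q ` ?S) \<le> card {0, 1 :: nat}" by (intro card_mono) simp_all
    then show "card (q ` ?S) + 4 \<le> card ?S" using dist by simp
  qed (use card_near_le_60 in simp_all)
qed

end

section \<open>Components, and the return to induced matchings\<close>

text \<open>Induction on the edge set. \<open>E1\<close> is the component of some edge: either it is
  all of \<open>E\<close> and \<open>no_critical_graph\<close> applies, or the colourings of
  \<open>E1\<close> and \<open>E - E1\<close> combine.\<close>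

lemma coloring_exists:
  assumes "finite E" "\<And>e. e \<in> E \<Longrightarrow> card e = 2" "\<And>v. degree E v \<le> 6"
  shows "\<exists>c. partial_coloring E 57 E c"
  using assms
proof (induction E rule: finite_psubset_induct)
  case (psubset E)
  show ?case
  proof (cases "E = {}")
    case True
    then show ?thesis by (simp add: partial_coloring_def)
  next
    case False
    then obtain e0 where e0: "e0 \<in> E" by blast
    then have "card e0 = 2" by (rule psubset.prems)
    then obtain v where v: "v \<in> e0" by fastforce
    let ?A = "{(x, y). {x, y} \<in> E}"
    define W where "W = {u. (v, u) \<in> ?A\<^sup>*}"
    define E1 where "E1 = {e \<in> E. e \<inter> W \<noteq> {}}"
    have step: "b \<in> W" if "{a, b} \<in> E" "a \<in> W" for a b
      using that rtrancl_into_rtrancl[of v a ?A b] by (simp add: W_def)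
    have step': "a \<in> W \<longleftrightarrow> b \<in> W" if "{a, b} \<in> E" for a b
      using that step[of a b] step[of b a] by (auto simp: insert_commute)
    have E1_W: "e \<subseteq> W" if "e \<in> E1" for e
    proof -
      have "e \<in> E" "e \<inter> W \<noteq> {}" using that by (simp_all add: E1_def)
      moreover from this obtain a b where "e = {a, b}" using psubset.prems(1) by (meson card_2_iff)
      ultimately show ?thesis using step'[of a b] by auto
    qed
    have e0E1: "e0 \<in> E1" using e0 v by (auto simp: E1_def W_def)
    show ?thesis
    proof (cases "E1 = E")
      case True
      have "(u, w) \<in> ?A\<^sup>*" if "u \<in> \<Union>E" "w \<in> \<Union>E" for u w
      proof -
        have "(v, u) \<in> ?A\<^sup>*" "(v, w) \<in> ?A\<^sup>*" using that E1_W True by (auto simp: W_def)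
        moreover have "sym (?A\<^sup>*)" by (intro sym_rtrancl symI) (auto simp: insert_commute)
        ultimately show ?thesis by (meson rtrancl_trans symD)
      qed
      then have "False" if "\<nexists>c. partial_coloring E 57 E c"
        using psubset.hyps psubset.prems that
        by (intro critical_graph.no_critical_graph[of E] critical_graph.intro degree6_graph.intro
            critical_graph_axioms.intro) auto
      then show ?thesis by blast
    next
      case False
      have deg: "degree F u \<le> 6" if "F \<subseteq> E" for F u
      proof -
        have "degree F u \<le> degree E u"
          unfolding degree_def using psubset.hyps that by (intro card_mono) auto
        then show ?thesis using psubset.prems(2)[of u] by simp
      qed
      have E1E: "E1 \<subset> E" using False by (auto simp: E1_def)
      have E2E: "E - E1 \<subset> E" using e0 e0E1 by blast
      obtain c1 where c1: "partial_coloring E1 57 E1 c1"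
        using psubset.IH[OF E1E] psubset.prems(1) deg E1E by blast
      obtain c2 where c2: "partial_coloring (E - E1) 57 (E - E1) c2"
        using psubset.IH[OF E2E] psubset.prems(1) deg E2E by blast
      \<comment> \<open>Neither a conflict nor an edge that causes it crosses between components, so
        a conflict in \<open>E\<close> is already one in the part that holds both edges.\<close>
      have same: "e \<in> E1 \<longleftrightarrow> f \<in> E1" "conflict (if e \<in> E1 then E1 else E - E1) e f"
        if "conflict E e f" "e \<in> E" "f \<in> E" for e f
      proof -
        obtain a b where ab: "e \<noteq> f" "a \<in> e" "b \<in> f" "a = b \<or> {a, b} \<in> E"
          using \<open>conflict E e f\<close> by (auto simp: conflict_def)
        have aW: "a \<in> W \<longleftrightarrow> b \<in> W" using ab(4) step' by blast
        have e: "e \<in> E1 \<longleftrightarrow> a \<in> W" using E1_W[of e] ab(2) that(2) by (auto simp: E1_def)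
        have f: "f \<in> E1 \<longleftrightarrow> b \<in> W" using E1_W[of f] ab(3) that(3) by (auto simp: E1_def)
        show "e \<in> E1 \<longleftrightarrow> f \<in> E1" using aW e f by blast
        have "a = b \<or> {a, b} \<in> (if e \<in> E1 then E1 else E - E1)"
          using ab(4) aW e by (auto simp: E1_def)
        then show "conflict (if e \<in> E1 then E1 else E - E1) e f"
          using ab(1-3) unfolding conflict_def by blast
      qed
      have "partial_coloring E 57 E (\<lambda>e. if e \<in> E1 then c1 e else c2 e)"
        unfolding partial_coloring_def
      proof (intro conjI ballI impI)
        fix e assume "e \<in> E"
        then show "(if e \<in> E1 then c1 e else c2 e) < 57"
          using c1 c2 by (simp add: partial_coloring_def)
      next
        fix e f assume "e \<in> E" "f \<in> E" "conflict E e f"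
        then show "(if e \<in> E1 then c1 e else c2 e) \<noteq> (if f \<in> E1 then c1 f else c2 f)"
          using same[of e f] c1 c2 by (auto simp: partial_coloring_def)
      qed
      then show ?thesis by blast
    qed
  qed
qed

text \<open>Distinct edges of one colour neither meet nor are joined by an edge. So an edge whose
  ends are covered by a class has both ends on the same member of the class and equals it.\<close>

lemma strong_edge_coloring_if_partial_coloring:
  assumes c: "partial_coloring E k E c" and E: "\<And>e. e \<in> E \<Longrightarrow> card e = 2"
  shows "strong_edge_coloring E k c"
  unfolding strong_edge_coloring_def
proof (intro conjI ballI allI impI)
  show "c e < k" if "e \<in> E" for e using c that by (simp add: partial_coloring_def)
  fix i
  let ?M = "{e \<in> E. c e = i}"
  have indep: "e = f \<or> a \<noteq> b \<and> {a, b} \<notin> E" if "e \<in> ?M" "f \<in> ?M" "a \<in> e" "b \<in> f" for e f a b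
  proof -
    have "\<not> conflict E e f"
      using c that(1,2) unfolding partial_coloring_def by (metis (mono_tags, lifting) mem_Collect_eq)
    then show ?thesis using that(3,4) unfolding conflict_def by blast
  qed
  have "matching E ?M"
    unfolding matching_def
  proof (intro conjI ballI impI)
    fix e f assume "e \<in> ?M" "f \<in> ?M" "e \<noteq> f"
    then show "e \<inter> f = {}" using indep[of e f] by blast
  qed blast
  moreover have "e \<in> ?M" if e: "e \<in> E" "e \<subseteq> \<Union>?M" for e
  proof -
    obtain a b where ab: "e = {a, b}" using E[OF e(1)] by (meson card_2_iff)
    obtain f g where fg: "f \<in> ?M" "a \<in> f" "g \<in> ?M" "b \<in> g" using e(2) ab by blast
    have "f = g" using indep[OF fg(1,3,2,4)] e(1) ab by blast
    then have "e \<subseteq> f" using fg ab by blast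
    moreover have "card e = card f" "finite f"
      using E[OF e(1)] E[of f] fg(1) card.infinite by fastforce+
    ultimately have "e = f" by (simp add: card_subset_eq)
    then show ?thesis using fg(1) by simp
  qed
  ultimately show "induced_matching E ?M" unfolding induced_matching_def by blast
qed

theorem theorem1p1:
  fixes V :: "'a set" and E :: "'a set set"
  assumes "finite_simple_graph V E"
    and "max_degree V E \<le> 6"
  shows "strong_chromatic_index E \<le> 57"
proof -
  have fin: "finite V" and E: "\<And>e. e \<in> E \<Longrightarrow> e \<subseteq> V \<and> card e = 2"
    using assms(1) by (simp_all add: finite_simple_graph_def)
  \<comment> \<open>\<open>coloring_exists\<close> asks for the bound at every element of the type;
    elements outside \<open>V\<close> lie on no edge.\<close>
  have "degree E v \<le> 6" for v
  proof (cases "v \<in> V")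
    case True
    then have "degree E v \<le> max_degree V E" unfolding max_degree_def using fin by simp
    then show ?thesis using assms(2) by simp
  next
    case False
    then have "{e \<in> E. v \<in> e} = {}" using E by blast
    then show ?thesis unfolding degree_def by (metis card.empty zero_le)
  qed
  then obtain c where "partial_coloring E 57 E c"
    using coloring_exists finite_simple_graph_finite_edges[OF assms(1)] E by blast
  then have "strong_edge_coloring E 57 c"
    using strong_edge_coloring_if_partial_coloring E by blast
  then show ?thesis unfolding strong_chromatic_index_def by (intro Least_le) blast
qed

end
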